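(* Let $H\in\mathcal D$ and let $\alpha'=(\alpha'_\delta,\alpha'_\delta,\dots)\in\bar{\mathbb A}_{\mathbb F}$ be a stationary Markov policy, i.e. $\alpha'_\delta(\mathbf x)\in\bar{\mathcal A}(\mathbf x)$ for every $\mathbf x\in\mathcal X$ and $\mathbf a_t=\alpha'_\delta(\mathbf x_t)$ for all $t$. Let $$\mathcal LH(\mathbf x_0)=H(\mathbf x_0)+\mathbb E\Big[\max_{\mathbf a\in\bar{\mathcal A}(\tau)}\Big\{\sum_{t=0}^{\tau}\Big(R(\mathbf x_t,\mathbf a_t)+\beta\,\mathbb E[H(\mathbf x_{t+1})\mid \mathbf x_t,\mathbf a_t]-H(\mathbf x_t)\Big)\Big\}\,\Big|\,\mathbf x_0\Big].$$ A necessary and sufficient condition for $V(\mathbf x_0;\alpha')=\mathcal LH(\mathbf x_0)$ for all $\mathbf x_0\in\mathcal X$ is that, for every initial state $\mathbf x_0\in\mathcal X$, for almost every $\omega\in\Omega$ and all $T=0,1,2,\dots$, $$\max_{\mathbf a\in\bar{\mathcal A}(T)}\Big\{\sum_{t=0}^{T}\big(R(\mathbf x_t,\mathbf a_t)+\beta\,\mathbb E[H(\mathbf x_{t+1})\mid\mathbf x_t,\mathbf a_t]-H(\mathbf x_t)\big)\Big\}=\sum_{t=0}^{T}\big(R(\mathbf x_t,\alpha'_\delta(\mathbf x_t))+\beta\,\mathbb E[H(\mathbf x_{t+1})\mid\mathbf x_t,\alpha'_\delta(\mathbf x_t)]-H(\mathbf x_t)\big),$$ where on the left $(\mathbf x_t)$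 is the trajectory generated by $\mathbf a$ and $\omega$, and on the right it is the trajectory generated by $\alpha'$ and $\omega$. In particular (case $T=0$), under this condition $$\alpha'_\delta(\mathbf x_0)\in\arg\max_{\mathbf a_0\in\bar{\mathcal A}(\mathbf x_0)}\{R(\mathbf x_0,\mathbf a_0)+\beta\,\mathbb E[H(\mathbf x_1)\mid\mathbf x_0,\mathbf a_0]\}\qquad\text{for all }\mathbf x_0\in\mathcal X.$$
   Context: Weakly coupled dynamic program. Fix integers $N,L\ge1$, a discount factor $\beta\in(0,1)$ and $\mathbf b\in\mathbb R^L$. For $n=1,\dots,N$, project $n$ has a state space $\mathcal X^n$, action sets $\mathcal A^n(x^n)$ for $x^n\in\mathcal X^n$, a controlled transition kernel $P_n(\cdot\mid x^n,a^n)$, a bounded reward $R^n(x^n,a^n)\in\mathbb R$, and a constraint function $\mathbf B^n(x^n,a^n)\in\mathbb R^L$. Put $\mathcal X=\prod_n\mathcal X^n$, $\mathcal A(\mathbf x)=\prod_n\mathcal A^n(x^n)$, $R(\mathbf x,\mathbf a)=\sum_nR^n(x^n,a^n)$, $\mathbf B(\mathbf x,\mathbf a)=\sum_n\mathbf B^n(x^n,a^n)$, and $\bar{\mathcal A}(\mathbf x)=\{\mathbf a\in\mathcal A(\mathbf x):\mathbf B(\mathbf x,\mathbf a)\le\mathbf b\}$ (componentwise). The joint transition law is the product $P(\cdot\mid\mathbf x,\mathbf a)=\prod_nP_n(\cdot\mid x^n,a^n)$, and $\mathbb E[H(\mathbf x_{t+1})\mid\mathbf x_t,\mathbf a_t]$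 denotes the integral of $H$ against $P(\cdot\mid\mathbf x_t,\mathbf a_t)$. Scenarios. On a probability space $(\Omega,\mathcal F,P)$ the states are functions of the scenario $\omega$ and of the past controls: $\mathbf x_0=\mathbf x_0(\omega)$ and $\mathbf x_{t+1}=\mathbf x_{t+1}(\mathbf a(t),\omega)$ with $\mathbf a(t)=(\mathbf a_0,\dots,\mathbf a_t)$. Let $\mathcal F_0=\sigma\{\mathbf x_0\}$ and $\mathcal F_t=\sigma\{\mathbf x_0,\dots,\mathbf x_t,\mathbf a_0,\dots,\mathbf a_{t-1}\}$. A policy $\alpha$ selects for each $\omega$ a control sequence with $\mathbf a_t\in\bar{\mathcal A}(\mathbf x_t)$ for all $t$; it is non-anticipative if each $\mathbf a_t$ is $\mathcal F_t$-measurable; the set of these policies is $\bar{\mathbb A}_{\mathbb F}$. Under a non-anticipative policy the conditional law of $\mathbf x_{t+1}$ given $\mathcal F_t$ is $P(\cdot\mid\mathbf x_t,\mathbf a_t)$. The value of $\alpha$ is $V(\mathbf x_0;\alpha)=\mathbb E[\sum_{t\ge0}\beta^tR(\mathbf x_t,\mathbf a_t)\mid\mathbf x_0]$. Statements "for almost every $\omega$" for a given initial state $\mathbf x_0$ refer to the probability conditional on that initial state. $\mathcal D$ is the set of bounded measurable functions $\mathcal X\to\mathbb R$. $\tau$ is a random time with $P(\tau=t)=(1-\beta)\beta^t$, $t=0,1,\dots$, independent of $\{\mathcal F_t\}$ and of $\omega$. For $T\in\mathbb N=\{0,1,\dots\}$ and a scenario $\omega$, $\bar{\mathcal A}(T)=\bar{\mathcal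 A}(\mathbf x_0)\times\cdots\times\bar{\mathcal A}(\mathbf x_T)$ is the set of $(\mathbf a_0,\dots,\mathbf a_T)$ with $\mathbf a_t\in\bar{\mathcal A}(\mathbf x_t)$ along the trajectory $\mathbf x_t=\mathbf x_t(\mathbf a(t-1),\omega)$ they generate; the maximum in $\mathcal LH$ is taken for each fixed $(\omega,\tau)$, and the expectation is over both $\omega$ and $\tau$. Maxima written are assumed to exist and to be measurable in $\omega$. *)

theory Defs
  imports "HOL-Probability.Probability"
begin

section \<open>Weakly coupled dynamic programs\<close>

text \<open>
  Projects are indexed by a finite type \<open>'n\<close> (so \<open>N = CARD('n)\<close>) and the linking constraints by a
  finite type \<open>'l\<close> (so \<open>L = CARD('l)\<close>). A state space or action space is a measurable space, of
  which only \<open>space\<close> and \<open>sets\<close> matter. Project-wise data at \<open>(x, a)\<close> are relevant only for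
  states \<open>x\<close> in the state space and actions \<open>a\<close> in the action set at \<open>x\<close>.
\<close>

record ('n::finite, 'l::finite, 'x, 'a) wcdp =
  project_states :: "'n \<Rightarrow> 'x measure"
  project_action_space :: "'n \<Rightarrow> 'a measure"
  project_actions :: "'n \<Rightarrow> 'x \<Rightarrow> 'a set"
  project_kernel :: "'n \<Rightarrow> 'x \<Rightarrow> 'a \<Rightarrow> 'x measure"
  project_reward :: "'n \<Rightarrow> 'x \<Rightarrow> 'a \<Rightarrow> real"
  project_constraint :: "'n \<Rightarrow> 'x \<Rightarrow> 'a \<Rightarrow> real ^ 'l"
  bound :: "real ^ 'l"
  discount :: real

definition project_graph ::
    "('n::finite, 'l::finite, 'x, 'a, 'z) wcdp_scheme \<Rightarrow> 'n \<Rightarrow> ('x \<times> 'a) set" where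
  "project_graph W n = {(x, a). x \<in> space (project_states W n) \<and> a \<in> project_actions W n x}"

definition is_wcdp :: "('n::finite, 'l::finite, 'x, 'a, 'z) wcdp_scheme \<Rightarrow> bool" where
  "is_wcdp W \<longleftrightarrow>
     0 < discount W \<and> discount W < 1 \<and>
     (\<forall>n. \<forall>x\<in>space (project_states W n). project_actions W n x \<subseteq> space (project_action_space W n)) \<and>
     (\<forall>n. (\<lambda>(x, a). project_kernel W n x a)
        \<in> restrict_space (project_states W n \<Otimes>\<^sub>M project_action_space W n) (project_graph W n)
          \<rightarrow>\<^sub>M prob_algebra (project_states W n)) \<and>
     (\<forall>n. (\<lambda>(x, a). project_reward W n x a)
        \<in> borel_measurable
            (restrict_space (project_states W n \<Otimes>\<^sub>M project_action_space W n) (project_graph W n))) \<and>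
     (\<forall>n. bounded ((\<lambda>(x, a). project_reward W n x a) ` project_graph W n))"

definition states :: "('n::finite, 'l::finite, 'x, 'a, 'z) wcdp_scheme \<Rightarrow> ('n \<Rightarrow> 'x) measure" where
  "states W = PiM UNIV (project_states W)"

definition action_space ::
    "('n::finite, 'l::finite, 'x, 'a, 'z) wcdp_scheme \<Rightarrow> ('n \<Rightarrow> 'a) measure" where
  "action_space W = PiM UNIV (project_action_space W)"

definition actions ::
    "('n::finite, 'l::finite, 'x, 'a, 'z) wcdp_scheme \<Rightarrow> ('n \<Rightarrow> 'x) \<Rightarrow> ('n \<Rightarrow> 'a) set" where
  "actions W x = {a. \<forall>n. a n \<in> project_actions W n (x n)}"

definition reward ::
    "('n::finite, 'l::finite, 'x, 'a, 'z) wcdp_scheme \<Rightarrow> ('n \<Rightarrow> 'x) \<Rightarrow> ('n \<Rightarrow> 'a) \<Rightarrow> real" where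
  "reward W x a = (\<Sum>n\<in>UNIV. project_reward W n (x n) (a n))"

definition linking ::
    "('n::finite, 'l::finite, 'x, 'a, 'z) wcdp_scheme \<Rightarrow> ('n \<Rightarrow> 'x) \<Rightarrow> ('n \<Rightarrow> 'a) \<Rightarrow> real ^ 'l" where
  "linking W x a = (\<Sum>n\<in>UNIV. project_constraint W n (x n) (a n))"

definition feasible_actions ::
    "('n::finite, 'l::finite, 'x, 'a, 'z) wcdp_scheme \<Rightarrow> ('n \<Rightarrow> 'x) \<Rightarrow> ('n \<Rightarrow> 'a) set" where
  "feasible_actions W x = {a \<in> actions W x. linking W x a \<le> bound W}"

definition transition ::
    "('n::finite, 'l::finite, 'x, 'a, 'z) wcdp_scheme \<Rightarrow> ('n \<Rightarrow> 'x) \<Rightarrow> ('n \<Rightarrow> 'a)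
      \<Rightarrow> ('n \<Rightarrow> 'x) measure" where
  "transition W x a = PiM UNIV (\<lambda>n. project_kernel W n (x n) (a n))"

definition next_exp ::
    "('n::finite, 'l::finite, 'x, 'a, 'z) wcdp_scheme \<Rightarrow> (('n \<Rightarrow> 'x) \<Rightarrow> real)
      \<Rightarrow> ('n \<Rightarrow> 'x) \<Rightarrow> ('n \<Rightarrow> 'a) \<Rightarrow> real" where
  "next_exp W H x a = (\<integral>y. H y \<partial>transition W x a)"

definition bounded_measurable ::
    "('n::finite, 'l::finite, 'x, 'a, 'z) wcdp_scheme \<Rightarrow> (('n \<Rightarrow> 'x) \<Rightarrow> real) set" where
  "bounded_measurable W = {H \<in> borel_measurable (states W). bounded (H ` space (states W))}"

definition step_gain ::
    "('n::finite, 'l::finite, 'x, 'a, 'z) wcdp_scheme \<Rightarrow> (('n \<Rightarrow> 'x) \<Rightarrow> real)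
      \<Rightarrow> ('n \<Rightarrow> 'x) \<Rightarrow> ('n \<Rightarrow> 'a) \<Rightarrow> real" where
  "step_gain W H x a = reward W x a + discount W * next_exp W H x a - H x"


section \<open>Scenarios and policies\<close>

text \<open>
  \<open>state_map W [a\<^sub>0, \<dots>, a\<^sub>t\<^sub>-\<^sub>1] \<omega>\<close> is the state at time \<open>t\<close> in scenario \<open>\<omega>\<close> after the past controls
  \<open>a\<^sub>0, \<dots>, a\<^sub>t\<^sub>-\<^sub>1\<close>; the empty list gives the initial state. \<open>cond_prob W x\<close> is the probability on the
  scenario space conditional on the initial state being \<open>x\<close>.
\<close>

record ('n::finite, 'l::finite, 'x, 'a, 'w) scenario_wcdp = "('n, 'l, 'x, 'a) wcdp" +
  scenarios :: "'w measure"
  state_map :: "('n \<Rightarrow> 'a) list \<Rightarrow> 'w \<Rightarrow> ('n \<Rightarrow> 'x)"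
  cond_prob :: "('n \<Rightarrow> 'x) \<Rightarrow> 'w measure"

text \<open>Control sequences \<open>(a\<^sub>0, \<dots>, a\<^sub>k\<^sub>-\<^sub>1)\<close> that are feasible along the trajectory they generate.\<close>

definition feasible_controls ::
    "('n::finite, 'l::finite, 'x, 'a, 'w) scenario_wcdp \<Rightarrow> nat \<Rightarrow> 'w \<Rightarrow> ('n \<Rightarrow> 'a) list set" where
  "feasible_controls W k \<omega> =
     {as. length as = k \<and> (\<forall>t<k. as ! t \<in> feasible_actions W (state_map W (take t as) \<omega>))}"

definition state_at ::
    "('n::finite, 'l::finite, 'x, 'a, 'w) scenario_wcdp \<Rightarrow> ('w \<Rightarrow> nat \<Rightarrow> 'n \<Rightarrow> 'a)
      \<Rightarrow> nat \<Rightarrow> 'w \<Rightarrow> ('n \<Rightarrow> 'x)" where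
  "state_at W \<alpha> t \<omega> = state_map W (map (\<alpha> \<omega>) [0..<t]) \<omega>"

text \<open>The \<open>\<sigma>\<close>-algebra generated by \<open>x\<^sub>0, \<dots>, x\<^sub>t, a\<^sub>0, \<dots>, a\<^sub>t\<^sub>-\<^sub>1\<close> under the policy \<open>\<alpha>\<close>.\<close>

definition history ::
    "('n::finite, 'l::finite, 'x, 'a, 'w) scenario_wcdp \<Rightarrow> ('w \<Rightarrow> nat \<Rightarrow> 'n \<Rightarrow> 'a)
      \<Rightarrow> nat \<Rightarrow> 'w measure" where
  "history W \<alpha> t = sigma (space (scenarios W))
     ((\<Union>s\<in>{..t}. {state_at W \<alpha> s -` C \<inter> space (scenarios W) | C. C \<in> sets (states W)}) \<union>
      (\<Union>s\<in>{..<t}. {(\<lambda>\<omega>. \<alpha> \<omega> s) -` D \<inter> space (scenarios W) | D. D \<in> sets (action_space W)}))"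

definition nonanticipative_policies ::
    "('n::finite, 'l::finite, 'x, 'a, 'w) scenario_wcdp \<Rightarrow> ('w \<Rightarrow> nat \<Rightarrow> 'n \<Rightarrow> 'a) set" where
  "nonanticipative_policies W =
     {\<alpha>. (\<forall>\<omega>\<in>space (scenarios W). \<forall>t. \<alpha> \<omega> t \<in> feasible_actions W (state_at W \<alpha> t \<omega>)) \<and>
         (\<forall>t. (\<lambda>\<omega>. \<alpha> \<omega> t) \<in> history W \<alpha> t \<rightarrow>\<^sub>M action_space W)}"

text \<open>
  The scenario model. \<open>cond_prob W\<close> is a regular conditional probability given \<open>x\<^sub>0\<close>, concentrated on
  the scenarios starting in the given state. It is defined for every initial state, not only up to
  null sets, and the controlled Markov property is accordingly required conditionally on every
  initial state; integrating over the law of \<open>x\<^sub>0\<close> gives it for \<open>scenarios W\<close> itself.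
\<close>

definition is_scenario_wcdp ::
    "('n::finite, 'l::finite, 'x, 'a, 'w) scenario_wcdp \<Rightarrow> bool" where
  "is_scenario_wcdp W \<longleftrightarrow>
     is_wcdp W \<and>
     prob_space (scenarios W) \<and>
     state_map W [] \<in> scenarios W \<rightarrow>\<^sub>M states W \<and>
     (\<forall>\<omega>\<in>space (scenarios W). \<forall>k. \<forall>as\<in>feasible_controls W k \<omega>. state_map W as \<omega> \<in> space (states W)) \<and>
     (\<forall>\<alpha>\<in>nonanticipative_policies W. \<forall>t. state_at W \<alpha> t \<in> scenarios W \<rightarrow>\<^sub>M states W) \<and>
     cond_prob W \<in> states W \<rightarrow>\<^sub>M prob_algebra (scenarios W) \<and>
     (\<forall>E\<in>sets (scenarios W). emeasure (scenarios W) E =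
        (\<integral>\<^sup>+\<omega>. emeasure (cond_prob W (state_map W [] \<omega>)) E \<partial>scenarios W)) \<and>
     (\<forall>x\<in>space (states W). AE \<omega> in cond_prob W x. state_map W [] \<omega> = x) \<and>
     (\<forall>\<alpha>\<in>nonanticipative_policies W. \<forall>x\<in>space (states W). \<forall>t. \<forall>C\<in>sets (states W).
        AE \<omega> in cond_prob W x.
          real_cond_exp (cond_prob W x) (history W \<alpha> t)
            (\<lambda>\<omega>'. indicator C (state_at W \<alpha> (Suc t) \<omega>')) \<omega>
          = measure (transition W (state_at W \<alpha> t \<omega>) (\<alpha> \<omega> t)) C)"

definition stationary_markov ::
    "('n::finite, 'l::finite, 'x, 'a, 'w) scenario_wcdp \<Rightarrow> ('w \<Rightarrow> nat \<Rightarrow> 'n \<Rightarrow> 'a)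
      \<Rightarrow> (('n \<Rightarrow> 'x) \<Rightarrow> ('n \<Rightarrow> 'a)) \<Rightarrow> bool" where
  "stationary_markov W \<alpha> \<delta> \<longleftrightarrow>
     (\<forall>x\<in>space (states W). \<delta> x \<in> feasible_actions W x) \<and>
     (\<forall>\<omega>\<in>space (scenarios W). \<forall>t. \<alpha> \<omega> t = \<delta> (state_at W \<alpha> t \<omega>))"

definition policy_value ::
    "('n::finite, 'l::finite, 'x, 'a, 'w) scenario_wcdp \<Rightarrow> ('w \<Rightarrow> nat \<Rightarrow> 'n \<Rightarrow> 'a)
      \<Rightarrow> ('n \<Rightarrow> 'x) \<Rightarrow> real" where
  "policy_value W \<alpha> x =
     (\<integral>\<omega>. (\<Sum>t. discount W ^ t * reward W (state_at W \<alpha> t \<omega>) (\<alpha> \<omega> t)) \<partial>cond_prob W x)"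


section \<open>Pathwise maximisation\<close>

definition path_gain ::
    "('n::finite, 'l::finite, 'x, 'a, 'w) scenario_wcdp \<Rightarrow> (('n \<Rightarrow> 'x) \<Rightarrow> real)
      \<Rightarrow> 'w \<Rightarrow> ('n \<Rightarrow> 'a) list \<Rightarrow> real" where
  "path_gain W H \<omega> as = (\<Sum>t<length as. step_gain W H (state_map W (take t as) \<omega>) (as ! t))"

text \<open>The maximum over the control sequences \<open>(a\<^sub>0, \<dots>, a\<^sub>T)\<close>; unspecified if it is not attained.\<close>

definition max_path_gain ::
    "('n::finite, 'l::finite, 'x, 'a, 'w) scenario_wcdp \<Rightarrow> (('n \<Rightarrow> 'x) \<Rightarrow> real)
      \<Rightarrow> nat \<Rightarrow> 'w \<Rightarrow> real" where
  "max_path_gain W H T \<omega> = (GREATEST v. v \<in> path_gain W H \<omega> ` feasible_controls W (Suc T) \<omega>)"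

definition maxima_exist_measurably ::
    "('n::finite, 'l::finite, 'x, 'a, 'w) scenario_wcdp \<Rightarrow> (('n \<Rightarrow> 'x) \<Rightarrow> real) \<Rightarrow> bool" where
  "maxima_exist_measurably W H \<longleftrightarrow>
     (\<forall>T. \<forall>\<omega>\<in>space (scenarios W). \<exists>as\<in>feasible_controls W (Suc T) \<omega>.
        \<forall>as'\<in>feasible_controls W (Suc T) \<omega>. path_gain W H \<omega> as' \<le> path_gain W H \<omega> as) \<and>
     (\<forall>T. max_path_gain W H T \<in> borel_measurable (scenarios W))"

text \<open>
  The law of \<open>\<tau>\<close>. Since \<open>\<tau>\<close> is independent of the scenario, \<open>(\<omega>, \<tau>)\<close> is distributed according to a
  product measure.
\<close>

definition tau_law :: "('n::finite, 'l::finite, 'x, 'a, 'z) wcdp_scheme \<Rightarrow> nat pmf" where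
  "tau_law W = geometric_pmf (1 - discount W)"

lemma pmf_tau_law: "is_wcdp W \<Longrightarrow> pmf (tau_law W) t = (1 - discount W) * discount W ^ t"
  by (simp add: tau_law_def is_wcdp_def)

definition L_op ::
    "('n::finite, 'l::finite, 'x, 'a, 'w) scenario_wcdp \<Rightarrow> (('n \<Rightarrow> 'x) \<Rightarrow> real)
      \<Rightarrow> ('n \<Rightarrow> 'x) \<Rightarrow> real" where
  "L_op W H x =
     H x + (\<integral>(\<omega>, T). max_path_gain W H T \<omega> \<partial>(cond_prob W x \<Otimes>\<^sub>M measure_pmf (tau_law W)))"

definition pathwise_maximal ::
    "('n::finite, 'l::finite, 'x, 'a, 'w) scenario_wcdp \<Rightarrow> (('n \<Rightarrow> 'x) \<Rightarrow> real)
      \<Rightarrow> ('w \<Rightarrow> nat \<Rightarrow> 'n \<Rightarrow> 'a) \<Rightarrow> (('n \<Rightarrow> 'x) \<Rightarrow> ('n \<Rightarrow> 'a)) \<Rightarrow> bool" where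
  "pathwise_maximal W H \<alpha> \<delta> \<longleftrightarrow>
     (\<forall>x\<in>space (states W). AE \<omega> in cond_prob W x. \<forall>T.
        max_path_gain W H T \<omega>
        = (\<Sum>t\<le>T. step_gain W H (state_at W \<alpha> t \<omega>) (\<delta> (state_at W \<alpha> t \<omega>))))"

end

theory Submission
  imports Defs
begin

text \<open>
  Write \<open>g\<^sub>t = R(x\<^sub>t, a\<^sub>t) + \<beta> E[H(x\<^sub>t\<^sub>+\<^sub>1) | x\<^sub>t, a\<^sub>t] - H(x\<^sub>t)\<close> for the one-step gains along the given policy,
  \<open>G\<^sub>T = g\<^sub>0 + \<dots> + g\<^sub>T\<close> for its path gain up to \<open>T\<close>, and \<open>M\<^sub>T\<close> for the maximal path gain. The
  policy is itself a competitor in the pathwise maximum, so \<open>M\<^sub>T \<ge> G\<^sub>T\<close> in every scenario. The proof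
  rests on the identity
  \<open>L H(x) - V(x; \<alpha>) = E[M\<^sub>\<tau> - G\<^sub>\<tau> | x\<^sub>0 = x]\<close>
  (\<open>L_op_minus_policy_value\<close>), whose right-hand side integrates a nonnegative function of
  \<open>(\<omega>, \<tau>)\<close>. It vanishes iff \<open>M\<^sub>\<tau> = G\<^sub>\<tau>\<close> almost surely, and since \<open>\<tau>\<close> is independent of \<open>\<omega>\<close> and charges
  every \<open>T\<close>, this means that for almost every \<open>\<omega>\<close> equality holds for all \<open>T\<close> at once
  (\<open>policy_value_eq_L_op_iff\<close>).

  The identity amounts to \<open>V(x; \<alpha>) = H(x) + E[G\<^sub>\<tau> | x\<^sub>0 = x]\<close> and has two ingredients. A geometric
  time with success probability \<open>1 - \<beta>\<close> survives up to \<open>t\<close> with probability \<open>\<beta>\<^sup>t\<close>, so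
  \<open>E[G\<^sub>\<tau>] = \<Sum>\<^sub>t \<beta>\<^sup>t E[g\<^sub>t]\<close> (\<open>expectation_geometric_partial_sums\<close>). And because
  \<open>E[H(x\<^sub>t\<^sub>+\<^sub>1) | x\<^sub>t, a\<^sub>t]\<close> has the same mean as \<open>H(x\<^sub>t\<^sub>+\<^sub>1)\<close> (\<open>expectation_next_exp\<close>), the terms with \<open>H\<close>
  telescope in the discounted sum and leave \<open>-H(x)\<close>
  (\<open>policy_value_eq_discounted_gains\<close>).

  The controlled Markov property speaks only of conditional probabilities of events
  \<open>x\<^sub>t\<^sub>+\<^sub>1 \<in> C\<close>. To pass from events to \<open>H\<close>, the joint transition law is shown to be a measurable kernel,
  so that the law of \<open>x\<^sub>t\<^sub>+\<^sub>1\<close> can be written as a mixture of transition laws.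
\<close>

section \<open>Geometric stopping\<close>

text \<open>
  The series over \<open>T\<close> is the Cauchy product of \<open>\<Sum>\<^sub>t b\<^sup>t e\<^sub>t\<close> with the geometric series, whose sum
  \<open>1 / (1 - b)\<close> the factor \<open>1 - b\<close> cancels.
\<close>

lemma geometric_partial_sums_sums:
  fixes e :: "nat \<Rightarrow> real"
  assumes b: "0 < b" "b < 1" and e: "\<And>t. \<bar>e t\<bar> \<le> K"
  shows "summable (\<lambda>t. b ^ t * e t)"
    and "(\<lambda>T. (1 - b) * b ^ T * (\<Sum>t\<le>T. e t)) sums (\<Sum>t. b ^ t * e t)"
proof -
  have geo: "summable (\<lambda>t. norm (b ^ t))"
    using b by (simp add: summable_geometric)
  have "summable (\<lambda>t. b ^ t)"
    using b by (simp add: summable_geometric)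
  then have dom: "summable (\<lambda>t. K * b ^ t)"
    by (rule summable_mult)
  have "norm (norm (b ^ t * e t)) \<le> K * b ^ t" for t
    using e[of t] b by (simp add: abs_mult mult.commute mult_left_mono)
  then have nrm: "summable (\<lambda>t. norm (b ^ t * e t))"
    by (intro summable_comparison_test'[OF dom, where N = 0])
  then show "summable (\<lambda>t. b ^ t * e t)"
    by (rule summable_norm_cancel)
  have "(\<lambda>T. \<Sum>t\<le>T. (b ^ t * e t) * b ^ (T - t)) sums ((\<Sum>t. b ^ t * e t) * (\<Sum>t. b ^ t))"
    by (rule Cauchy_product_sums[OF nrm geo])
  also have "(\<lambda>T. \<Sum>t\<le>T. (b ^ t * e t) * b ^ (T - t)) = (\<lambda>T. b ^ T * (\<Sum>t\<le>T. e t))"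
    by (auto simp: sum_distrib_left power_add[symmetric] intro!: sum.cong)
  finally have "(\<lambda>T. (1 - b) * (b ^ T * (\<Sum>t\<le>T. e t))) sums
      ((1 - b) * ((\<Sum>t. b ^ t * e t) * (\<Sum>t. b ^ t)))"
    by (rule sums_mult)
  then show "(\<lambda>T. (1 - b) * b ^ T * (\<Sum>t\<le>T. e t)) sums (\<Sum>t. b ^ t * e t)"
    using b by (simp add: suminf_geometric mult.assoc)
qed

lemma expectation_geometric_partial_sums:
  fixes e :: "nat \<Rightarrow> real"
  assumes b: "0 < b" "b < 1" and e: "\<And>t. \<bar>e t\<bar> \<le> K"
  shows "measure_pmf.expectation (geometric_pmf (1 - b)) (\<lambda>T. \<Sum>t\<le>T. e t) = (\<Sum>t. b ^ t * e t)"
proof -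
  have dom: "summable (\<lambda>T. (1 - b) * b ^ T * (\<Sum>t\<le>T. \<bar>e t\<bar>))"
    using geometric_partial_sums_sums(2)[OF b, of "\<lambda>t. \<bar>e t\<bar>" K] e by (auto simp: sums_iff)
  have "norm (norm (b ^ T * (1 - b) * (\<Sum>t\<le>T. e t))) \<le> (1 - b) * b ^ T * (\<Sum>t\<le>T. \<bar>e t\<bar>)" for T
    using b sum_abs[of e "{..T}"] by (simp add: abs_mult mult_ac mult_left_mono)
  then have "summable (\<lambda>T. norm (b ^ T * (1 - b) * (\<Sum>t\<le>T. e t)))"
    by (intro summable_comparison_test'[OF dom, where N = 0])
  then have int: "integrable (count_space UNIV) (\<lambda>T. pmf (geometric_pmf (1 - b)) T * (\<Sum>t\<le>T. e t))"
    using b by (simp add: integrable_count_space_nat_iff)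
  have "measure_pmf.expectation (geometric_pmf (1 - b)) (\<lambda>T. \<Sum>t\<le>T. e t)
      = (\<integral>T. pmf (geometric_pmf (1 - b)) T * (\<Sum>t\<le>T. e t) \<partial>count_space UNIV)"
    unfolding measure_pmf_eq_density by (subst integral_density) auto
  also have "\<dots> = (\<Sum>T. (1 - b) * b ^ T * (\<Sum>t\<le>T. e t))"
    using b by (subst integral_count_space_nat[OF int]) (simp add: mult_ac)
  also have "\<dots> = (\<Sum>t. b ^ t * e t)"
    using geometric_partial_sums_sums(2)[OF b e] by (simp add: sums_iff)
  finally show ?thesis .
qed

text \<open>
  Path gains grow at most linearly in the horizon. A geometric time has a finite mean, so this is
  enough for integrability over scenario and horizon together.
\<close>

lemma integrable_geometric_linear_growth:
  fixes f :: "'w \<times> nat \<Rightarrow> real"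
  assumes P: "prob_space P" and p: "0 < p" "p \<le> 1"
    and f: "f \<in> borel_measurable (P \<Otimes>\<^sub>M measure_pmf (geometric_pmf p))"
    and le: "\<And>\<omega> T. \<omega> \<in> space P \<Longrightarrow> \<bar>f (\<omega>, T)\<bar> \<le> K * (real T + 1)"
  shows "integrable (P \<Otimes>\<^sub>M measure_pmf (geometric_pmf p)) f"
proof -
  let ?Q = "measure_pmf (geometric_pmf p)"
  interpret prob_P: prob_space P by fact
  interpret pair_prob_space P ?Q ..
  have "integrable ?Q real"
    using p by (intro integrable_real_geometric_pmf) auto
  then have "integrable ?Q (\<lambda>T. real T + 1)"
    by (rule Bochner_Integration.integrable_add) simp
  then have int: "integrable ?Q (\<lambda>T. K * (real T + 1))"
    by (rule integrable_mult_right)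
  have m: "(\<lambda>z. K * (real (snd z) + 1)) \<in> borel_measurable (P \<Otimes>\<^sub>M ?Q)"
    by (intro measurable_compose[OF measurable_snd]) simp
  have g: "integrable (P \<Otimes>\<^sub>M ?Q) (\<lambda>z. K * (real (snd z) + 1))"
  proof (rule Fubini_integrable[OF m])
    show "integrable P (\<lambda>\<omega>. \<integral>T. norm (K * (real (snd (\<omega>, T)) + 1)) \<partial>?Q)"
      unfolding snd_conv by (rule prob_P.integrable_const)
    show "AE \<omega> in P. integrable ?Q (\<lambda>T. K * (real (snd (\<omega>, T)) + 1))"
      unfolding snd_conv using int by (rule AE_I2)
  qed
  show ?thesis
  proof (rule Bochner_Integration.integrable_bound[OF g f], rule AE_I2)
    fix z assume "z \<in> space (P \<Otimes>\<^sub>M ?Q)"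
    then have "\<bar>f (fst z, snd z)\<bar> \<le> K * (real (snd z) + 1)"
      by (intro le) (auto simp: space_pair_measure)
    then show "norm (f z) \<le> norm (K * (real (snd z) + 1))"
      by simp
  qed
qed

section \<open>Products of probability kernels\<close>

text \<open>
  On a measurable rectangle the product measure is the finite product of the factors, which is
  measurable in the parameter; rectangles generate the product sigma-algebra and are closed under
  intersection.
\<close>

lemma measurable_PiM_kernel:
  fixes K :: "'n::finite \<Rightarrow> 'w \<Rightarrow> 'x measure"
  assumes K: "\<And>n. K n \<in> M \<rightarrow>\<^sub>M prob_algebra (S n)"
  shows "(\<lambda>\<omega>. PiM UNIV (\<lambda>n. K n \<omega>)) \<in> M \<rightarrow>\<^sub>M prob_algebra (PiM UNIV S)"
proof (rule measurable_prob_algebra_generated[OF sets_PiM Int_stable_prod_algebra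
        prod_algebra_sets_into_space])
  have K': "sets (K n \<omega>) = sets (S n)" "prob_space (K n \<omega>)" if "\<omega> \<in> space M" for n \<omega>
    using measurable_space[OF K that] by (auto simp: space_prob_algebra)
  show "prob_space (PiM UNIV (\<lambda>n. K n \<omega>))" "sets (PiM UNIV (\<lambda>n. K n \<omega>)) = sets (PiM UNIV S)"
    if "\<omega> \<in> space M" for \<omega>
    using K'[OF that] by (auto intro!: prob_space_PiM sets_PiM_cong)
  fix A assume "A \<in> prod_algebra UNIV S"
  then obtain X where A: "A = Pi\<^sub>E UNIV X" and X: "\<And>n. X n \<in> sets (S n)"
    by (auto simp: prod_algebra_eq_finite)
  have "emeasure (PiM UNIV (\<lambda>n. K n \<omega>)) A = (\<Prod>n\<in>UNIV. emeasure (K n \<omega>) (X n))"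
    if "\<omega> \<in> space M" for \<omega>
  proof -
    interpret product_prob_space "\<lambda>n. K n \<omega>" UNIV
      using K'(2)[OF that] by (auto intro!: product_prob_spaceI)
    show ?thesis
      unfolding A using X K'(1)[OF that] by (intro emeasure_PiM) auto
  qed
  moreover have "(\<lambda>\<omega>. \<Prod>n\<in>UNIV. emeasure (K n \<omega>) (X n)) \<in> borel_measurable M"
    using X K by (intro borel_measurable_prod_ennreal
        measurable_emeasure_kernel[OF measurable_prob_algebraD])
  ultimately show "(\<lambda>\<omega>. emeasure (PiM UNIV (\<lambda>n. K n \<omega>)) A) \<in> borel_measurable M"
    by (simp cong: measurable_cong)
qed

section \<open>Rewards, transitions and one-step gains\<close>

text \<open>
  Project data are measurable only on the graph of the admissible state-action pairs, so the
  measurability of rewards and transition laws is stated for a random admissible pair \<open>(X, A)\<close>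
  rather than for functions on the whole product space.
\<close>

lemma measurable_project_pair:
  assumes W: "is_wcdp W"
    and X: "X \<in> M \<rightarrow>\<^sub>M states W" and A: "A \<in> M \<rightarrow>\<^sub>M action_space W"
    and XA: "\<And>\<omega>. \<omega> \<in> space M \<Longrightarrow> A \<omega> \<in> actions W (X \<omega>)"
  shows "(\<lambda>\<omega>. (X \<omega> n, A \<omega> n)) \<in> M \<rightarrow>\<^sub>M
    restrict_space (project_states W n \<Otimes>\<^sub>M project_action_space W n) (project_graph W n)"
proof (rule measurable_restrict_space2)
  have Xn: "(\<lambda>\<omega>. X \<omega> n) \<in> M \<rightarrow>\<^sub>M project_states W n"
    using X by (auto simp: states_def intro: measurable_compose[OF _ measurable_component_singleton])
  have An: "(\<lambda>\<omega>. A \<omega> n) \<in> M \<rightarrow>\<^sub>M project_action_space W n"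
    using A by (auto simp: action_space_def intro: measurable_compose[OF _ measurable_component_singleton])
  show "(\<lambda>\<omega>. (X \<omega> n, A \<omega> n)) \<in> M \<rightarrow>\<^sub>M project_states W n \<Otimes>\<^sub>M project_action_space W n"
    using Xn An by simp
  show "(\<lambda>\<omega>. (X \<omega> n, A \<omega> n)) \<in> space M \<rightarrow> project_graph W n"
    using measurable_space[OF Xn] XA by (auto simp: project_graph_def actions_def)
qed

lemma measurable_reward:
  assumes "is_wcdp W" "X \<in> M \<rightarrow>\<^sub>M states W" "A \<in> M \<rightarrow>\<^sub>M action_space W"
    and "\<And>\<omega>. \<omega> \<in> space M \<Longrightarrow> A \<omega> \<in> actions W (X \<omega>)"
  shows "(\<lambda>\<omega>. reward W (X \<omega>) (A \<omega>)) \<in> borel_measurable M"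
proof -
  have "(\<lambda>\<omega>. project_reward W n (X \<omega> n) (A \<omega> n)) \<in> borel_measurable M" for n
    using measurable_compose[OF measurable_project_pair[OF assms, of n],
        of "\<lambda>(x, a). project_reward W n x a" borel] assms(1)
    by (auto simp: is_wcdp_def)
  then show ?thesis
    unfolding reward_def by (intro borel_measurable_sum)
qed

lemma measurable_transition:
  assumes "is_wcdp W" "X \<in> M \<rightarrow>\<^sub>M states W" "A \<in> M \<rightarrow>\<^sub>M action_space W"
    and "\<And>\<omega>. \<omega> \<in> space M \<Longrightarrow> A \<omega> \<in> actions W (X \<omega>)"
  shows "(\<lambda>\<omega>. transition W (X \<omega>) (A \<omega>)) \<in> M \<rightarrow>\<^sub>M prob_algebra (states W)"
proof -
  have "(\<lambda>\<omega>. project_kernel W n (X \<omega> n) (A \<omega> n)) \<in> M \<rightarrow>\<^sub>M prob_algebra (project_states W n)" for n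
    using measurable_compose[OF measurable_project_pair[OF assms, of n],
        of "\<lambda>(x, a). project_kernel W n x a" "prob_algebra (project_states W n)"] assms(1)
    by (auto simp: is_wcdp_def)
  then show ?thesis
    unfolding transition_def states_def by (rule measurable_PiM_kernel)
qed

lemma actions_in_action_space:
  assumes "is_wcdp W" "x \<in> space (states W)" "a \<in> actions W x"
  shows "a \<in> space (action_space W)"
  using assms
  by (fastforce simp: is_wcdp_def actions_def states_def action_space_def space_PiM PiE_iff)

lemma transition_prob:
  assumes "is_wcdp W" "x \<in> space (states W)" "a \<in> actions W x"
  shows "prob_space (transition W x a)" and "sets (transition W x a) = sets (states W)"
proof -
  (* A fixed pair is a random pair on a one-point space. *)
  have "(\<lambda>_. transition W x a) \<in> count_space {()} \<rightarrow>\<^sub>M prob_algebra (states W)"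
    using assms actions_in_action_space[OF assms]
    by (intro measurable_transition) auto
  then show "prob_space (transition W x a)" "sets (transition W x a) = sets (states W)"
    by (auto dest!: measurable_space simp: space_prob_algebra)
qed

lemma reward_bounded:
  assumes "is_wcdp W"
  obtains K where "\<And>x a. x \<in> space (states W) \<Longrightarrow> a \<in> actions W x \<Longrightarrow> \<bar>reward W x a\<bar> \<le> K"
proof -
  have "\<forall>n. \<exists>c. \<forall>x a. (x, a) \<in> project_graph W n \<longrightarrow> \<bar>project_reward W n x a\<bar> \<le> c"
    using assms by (fastforce simp: is_wcdp_def bounded_iff)
  then obtain c where c: "\<And>n x a. (x, a) \<in> project_graph W n \<Longrightarrow> \<bar>project_reward W n x a\<bar> \<le> c n"
    by metis
  show thesis
  proof (rule that)
    fix x a assume "x \<in> space (states W)" "a \<in> actions W x"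
    then have "(x n, a n) \<in> project_graph W n" for n
      by (auto simp: states_def space_PiM PiE_iff actions_def project_graph_def)
    then show "\<bar>reward W x a\<bar> \<le> (\<Sum>n\<in>UNIV. c n)"
      unfolding reward_def by (intro order.trans[OF sum_abs] sum_mono c)
  qed
qed

lemma next_exp_bounded:
  assumes W: "is_wcdp W" and H: "H \<in> bounded_measurable W"
    and c: "\<And>x. x \<in> space (states W) \<Longrightarrow> \<bar>H x\<bar> \<le> c"
    and xa: "x \<in> space (states W)" "a \<in> actions W x"
  shows "\<bar>next_exp W H x a\<bar> \<le> c"
proof -
  note tr = transition_prob[OF W xa]
  interpret prob_space "transition W x a" by (rule tr)
  have sp: "space (transition W x a) = space (states W)"
    using tr(2) by (rule sets_eq_imp_space_eq)
  have meas: "H \<in> borel_measurable (transition W x a)"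
    using H tr(2) by (simp add: bounded_measurable_def cong: measurable_cong_sets)
  have int: "integrable (transition W x a) H"
    using c sp meas by (intro integrable_const_bound[where B = c]) auto
  have "(\<integral>y. \<bar>H y\<bar> \<partial>transition W x a) \<le> c"
    using c sp int by (intro integral_le_const) auto
  then show ?thesis
    unfolding next_exp_def using integral_abs_bound[of "transition W x a" H] by linarith
qed

lemma step_gain_bounded:
  assumes W: "is_wcdp W" and H: "H \<in> bounded_measurable W"
  obtains K where "\<And>x a. x \<in> space (states W) \<Longrightarrow> a \<in> actions W x \<Longrightarrow> \<bar>step_gain W H x a\<bar> \<le> K"
proof -
  obtain r where r: "\<And>x a. x \<in> space (states W) \<Longrightarrow> a \<in> actions W x \<Longrightarrow> \<bar>reward W x a\<bar> \<le> r"
    using reward_bounded[OF W] by blast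
  obtain c where c: "\<And>x. x \<in> space (states W) \<Longrightarrow> \<bar>H x\<bar> \<le> c"
    using H by (auto simp: bounded_measurable_def bounded_iff)
  have b: "0 < discount W" "discount W < 1"
    using W by (auto simp: is_wcdp_def)
  show thesis
  proof (rule that[of "\<bar>r\<bar> + \<bar>c\<bar> + \<bar>c\<bar>"])
    fix x a assume xa: "x \<in> space (states W)" "a \<in> actions W x"
    have "\<bar>discount W * next_exp W H x a\<bar> \<le> 1 * \<bar>next_exp W H x a\<bar>"
      using b unfolding abs_mult by (intro mult_right_mono) auto
    then show "\<bar>step_gain W H x a\<bar> \<le> \<bar>r\<bar> + \<bar>c\<bar> + \<bar>c\<bar>"
      using r[OF xa] c[OF xa(1)] next_exp_bounded[OF W H c xa]
      unfolding step_gain_def by linarith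
  qed
qed

lemma measurable_next_exp:
  assumes "is_wcdp W" "X \<in> M \<rightarrow>\<^sub>M states W" "A \<in> M \<rightarrow>\<^sub>M action_space W"
    and "\<And>\<omega>. \<omega> \<in> space M \<Longrightarrow> A \<omega> \<in> actions W (X \<omega>)"
    and "H \<in> bounded_measurable W"
  shows "(\<lambda>\<omega>. next_exp W H (X \<omega>) (A \<omega>)) \<in> borel_measurable M"
proof -
  have "H \<in> borel_measurable (states W)"
    using assms(5) by (simp add: bounded_measurable_def)
  then show ?thesis
    unfolding next_exp_def
    by (intro measurable_compose[OF measurable_prob_algebraD[OF measurable_transition[OF assms(1-4)]]]
        integral_measurable_subprob_algebra)
qed

section \<open>Trajectories of a non-anticipative policy\<close>

text \<open>
  Actions are known to be measurable only with respect to the history, and the history is a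
  sub-sigma-algebra of the scenario space only if the earlier actions are measurable there. The two
  facts are therefore established together by induction on time.
\<close>

lemma nonanticipative_policy_measurable:
  assumes S: "is_scenario_wcdp W" and \<alpha>: "\<alpha> \<in> nonanticipative_policies W"
  shows "state_at W \<alpha> t \<in> scenarios W \<rightarrow>\<^sub>M states W"
    and "(\<lambda>\<omega>. \<alpha> \<omega> t) \<in> scenarios W \<rightarrow>\<^sub>M action_space W"
    and "subalgebra (scenarios W) (history W \<alpha> t)"
proof -
  show X: "state_at W \<alpha> t \<in> scenarios W \<rightarrow>\<^sub>M states W" for t
    using assms by (auto simp: is_scenario_wcdp_def)
  have sub: "subalgebra (scenarios W) (history W \<alpha> t)"
    if "\<And>s. s < t \<Longrightarrow> (\<lambda>\<omega>. \<alpha> \<omega> s) \<in> scenarios W \<rightarrow>\<^sub>M action_space W" for t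
  proof -
    let ?G = "(\<Union>s\<in>{..t}. {state_at W \<alpha> s -` C \<inter> space (scenarios W) | C. C \<in> sets (states W)}) \<union>
      (\<Union>s\<in>{..<t}. {(\<lambda>\<omega>. \<alpha> \<omega> s) -` D \<inter> space (scenarios W) | D. D \<in> sets (action_space W)})"
    have G: "?G \<subseteq> sets (scenarios W)"
      using measurable_sets[OF X] measurable_sets[OF that] by blast
    then have "?G \<subseteq> Pow (space (scenarios W))"
      using sets.space_closed by blast
    then show ?thesis
      unfolding subalgebra_def history_def
      using sets.sigma_sets_subset[OF G] by simp
  qed
  have A: "(\<lambda>\<omega>. \<alpha> \<omega> t) \<in> scenarios W \<rightarrow>\<^sub>M action_space W" for t
  proof (induction t rule: less_induct)
    case (less t)
    then have "subalgebra (scenarios W) (history W \<alpha> t)"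
      by (rule sub)
    moreover have "(\<lambda>\<omega>. \<alpha> \<omega> t) \<in> history W \<alpha> t \<rightarrow>\<^sub>M action_space W"
      using \<alpha> by (auto simp: nonanticipative_policies_def)
    ultimately show ?case
      by (rule measurable_from_subalg)
  qed
  then show "(\<lambda>\<omega>. \<alpha> \<omega> t) \<in> scenarios W \<rightarrow>\<^sub>M action_space W" .
  show "subalgebra (scenarios W) (history W \<alpha> t)"
    using A by (rule sub)
qed

lemma nonanticipative_policy_actions:
  assumes "is_scenario_wcdp W" "\<alpha> \<in> nonanticipative_policies W" "\<omega> \<in> space (scenarios W)"
  shows "state_at W \<alpha> t \<omega> \<in> space (states W)" "\<alpha> \<omega> t \<in> actions W (state_at W \<alpha> t \<omega>)"
  using measurable_space[OF nonanticipative_policy_measurable(1)[OF assms(1,2)] assms(3)] assms(2,3)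
  by (auto simp: nonanticipative_policies_def feasible_actions_def)

lemma cond_prob_prob:
  assumes "is_scenario_wcdp W" "x \<in> space (states W)"
  shows "prob_space (cond_prob W x)" "sets (cond_prob W x) = sets (scenarios W)"
    "space (cond_prob W x) = space (scenarios W)"
proof -
  have "cond_prob W x \<in> space (prob_algebra (scenarios W))"
    using assms by (auto simp: is_scenario_wcdp_def dest: measurable_space)
  then show "prob_space (cond_prob W x)" and s: "sets (cond_prob W x) = sets (scenarios W)"
    by (auto simp: space_prob_algebra)
  show "space (cond_prob W x) = space (scenarios W)"
    using s by (rule sets_eq_imp_space_eq)
qed

text \<open>
  Taking expectations in the controlled Markov property: a conditional probability of
  \<open>x\<^sub>t\<^sub>+\<^sub>1 \<in> C\<close> has the probability of this event as its mean.
\<close>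

lemma law_of_next_state:
  assumes S: "is_scenario_wcdp W" and \<alpha>: "\<alpha> \<in> nonanticipative_policies W"
    and x: "x \<in> space (states W)"
  shows "distr (cond_prob W x) (states W) (state_at W \<alpha> (Suc t))
    = cond_prob W x \<bind> (\<lambda>\<omega>. transition W (state_at W \<alpha> t \<omega>) (\<alpha> \<omega> t))"
proof -
  let ?P = "cond_prob W x"
  let ?K = "\<lambda>\<omega>. transition W (state_at W \<alpha> t \<omega>) (\<alpha> \<omega> t)"
  note P = cond_prob_prob[OF S x]
  note mP = measurable_cong_sets[OF P(2) refl]
  note pol = nonanticipative_policy_measurable[OF S \<alpha>]
  note act = nonanticipative_policy_actions[OF S \<alpha>]
  interpret P: prob_space ?P by (rule P)
  have W: "is_wcdp W" using S by (simp add: is_scenario_wcdp_def)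
  have sub: "subalgebra ?P (history W \<alpha> t)"
    using pol(3)[of t] P(2,3) by (simp add: subalgebra_def)
  interpret F: finite_measure_subalgebra ?P "history W \<alpha> t"
    by unfold_locales (rule sub)
  have X': "state_at W \<alpha> (Suc t) \<in> ?P \<rightarrow>\<^sub>M states W"
    using pol(1) by (simp add: mP)
  have K: "?K \<in> ?P \<rightarrow>\<^sub>M prob_algebra (states W)"
    using pol(1,2) act P(3) by (intro measurable_transition[OF W]) (auto simp: mP)
  have Psp: "?P \<in> space (prob_algebra ?P)"
    using P by (simp add: space_prob_algebra)
  show ?thesis
  proof (rule measure_eqI)
    show "sets (distr ?P (states W) (state_at W \<alpha> (Suc t))) = sets (?P \<bind> ?K)"
      using sets_bind'[OF Psp K] by simp
    fix C assume "C \<in> sets (distr ?P (states W) (state_at W \<alpha> (Suc t)))"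
    then have C: "C \<in> sets (states W)" by simp
    let ?I = "\<lambda>\<omega>. indicator C (state_at W \<alpha> (Suc t) \<omega>) :: real"
    have Imeas: "?I \<in> borel_measurable ?P"
      using C by (intro measurable_compose[OF X']) simp
    have I: "integrable ?P ?I"
      using Imeas by (intro P.integrable_const_bound[where B = 1]) (auto simp: indicator_def)
    have Kmeas: "(\<lambda>\<omega>. measure (?K \<omega>) C) \<in> borel_measurable ?P"
      using C by (intro measurable_compose[OF measurable_prob_algebraD[OF K]] measurable_measure_subprob_algebra)
    have Kprob: "prob_space (?K \<omega>)" if "\<omega> \<in> space ?P" for \<omega>
      using act[of \<omega> t] that P(3) transition_prob(1)[OF W] by simp
    have AE: "AE \<omega> in ?P. real_cond_exp ?P (history W \<alpha> t) ?I \<omega> = measure (?K \<omega>) C"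
      using S \<alpha> x C by (auto simp: is_scenario_wcdp_def)
    have "measure ?P (state_at W \<alpha> (Suc t) -` C \<inter> space ?P)
        = (\<integral>\<omega>. indicator (state_at W \<alpha> (Suc t) -` C \<inter> space ?P) \<omega> \<partial>?P)"
      using measurable_sets[OF X' C] by simp
    also have "\<dots> = (\<integral>\<omega>. ?I \<omega> \<partial>?P)"
      by (intro Bochner_Integration.integral_cong) (auto simp: indicator_def)
    also have "\<dots> = (\<integral>\<omega>. real_cond_exp ?P (history W \<alpha> t) ?I \<omega> \<partial>?P)"
      using F.real_cond_exp_int(2)[OF I] by simp
    also have "\<dots> = (\<integral>\<omega>. measure (?K \<omega>) C \<partial>?P)"
      using AE Kmeas F.real_cond_exp_int(1)[OF I] by (intro integral_cong_AE) auto
    finally have eq: "measure ?P (state_at W \<alpha> (Suc t) -` C \<inter> space ?P) = (\<integral>\<omega>. measure (?K \<omega>) C \<partial>?P)" .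
    have Kint: "integrable ?P (\<lambda>\<omega>. measure (?K \<omega>) C)"
      using Kmeas Kprob
      by (intro P.integrable_const_bound[where B = 1] AE_I2) (auto simp: prob_space.prob_le_1)
    have "emeasure (distr ?P (states W) (state_at W \<alpha> (Suc t))) C
        = ennreal (\<integral>\<omega>. measure (?K \<omega>) C \<partial>?P)"
      using X' C by (simp add: emeasure_distr P.emeasure_eq_measure eq)
    also have "\<dots> = (\<integral>\<^sup>+\<omega>. ennreal (measure (?K \<omega>) C) \<partial>?P)"
      using Kint by (intro nn_integral_eq_integral[symmetric]) auto
    also have "\<dots> = (\<integral>\<^sup>+\<omega>. emeasure (?K \<omega>) C \<partial>?P)"
      using Kprob by (intro nn_integral_cong)
        (simp add: finite_measure.emeasure_eq_measure prob_space.finite_measure)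
    also have "\<dots> = emeasure (?P \<bind> ?K) C"
      using emeasure_bind_prob_algebra[OF Psp K C] by simp
    finally show "emeasure (distr ?P (states W) (state_at W \<alpha> (Suc t))) C = emeasure (?P \<bind> ?K) C" .
  qed
qed

lemma expectation_next_exp:
  assumes S: "is_scenario_wcdp W" and \<alpha>: "\<alpha> \<in> nonanticipative_policies W"
    and x: "x \<in> space (states W)" and H: "H \<in> bounded_measurable W"
  shows "(\<integral>\<omega>. next_exp W H (state_at W \<alpha> t \<omega>) (\<alpha> \<omega> t) \<partial>cond_prob W x)
    = (\<integral>\<omega>. H (state_at W \<alpha> (Suc t) \<omega>) \<partial>cond_prob W x)"
proof -
  let ?P = "cond_prob W x"
  let ?K = "\<lambda>\<omega>. transition W (state_at W \<alpha> t \<omega>) (\<alpha> \<omega> t)"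
  note P = cond_prob_prob[OF S x]
  note mP = measurable_cong_sets[OF P(2) refl]
  note pol = nonanticipative_policy_measurable[OF S \<alpha>]
  note act = nonanticipative_policy_actions[OF S \<alpha>]
  interpret P: prob_space ?P by (rule P)
  have W: "is_wcdp W" using S by (simp add: is_scenario_wcdp_def)
  have K: "?K \<in> ?P \<rightarrow>\<^sub>M prob_algebra (states W)"
    using pol(1,2) act P(3) by (intro measurable_transition[OF W]) (auto simp: mP)
  have Hm: "H \<in> borel_measurable (states W)"
    using H by (simp add: bounded_measurable_def)
  obtain c where c: "\<And>x. x \<in> space (states W) \<Longrightarrow> \<bar>H x\<bar> \<le> c"
    using H by (auto simp: bounded_measurable_def bounded_iff)
  have "(\<integral>\<omega>. H (state_at W \<alpha> (Suc t) \<omega>) \<partial>?P)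
      = (\<integral>y. H y \<partial>distr ?P (states W) (state_at W \<alpha> (Suc t)))"
    using pol(1) Hm by (simp add: integral_distr mP)
  also have "\<dots> = (\<integral>y. H y \<partial>(?P \<bind> ?K))"
    unfolding law_of_next_state[OF S \<alpha> x] ..
  also have "\<dots> = (\<integral>\<omega>. (\<integral>y. H y \<partial>?K \<omega>) \<partial>?P)"
  proof (rule integral_bind[where K = "states W" and B = c and B' = 1])
    show "?K \<in> ?P \<rightarrow>\<^sub>M subprob_algebra (states W)"
      using K by (rule measurable_prob_algebraD)
    show "AE \<omega> in ?P. emeasure (?K \<omega>) (space (?K \<omega>)) \<le> ennreal 1"
      using measurable_space[OF K]
      by (auto simp: space_prob_algebra prob_space.emeasure_space_1)
  qed (use Hm c in \<open>auto intro: P.finite_measure_axioms\<close>)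
  finally show ?thesis
    by (simp add: next_exp_def)
qed


text \<open>All integrands are bounded along trajectories, and the conditional laws are finite.\<close>

lemma integrable_along_policy:
  assumes S: "is_scenario_wcdp W" and \<alpha>: "\<alpha> \<in> nonanticipative_policies W"
    and x: "x \<in> space (states W)" and H: "H \<in> bounded_measurable W"
  shows "integrable (cond_prob W x) (\<lambda>\<omega>. reward W (state_at W \<alpha> t \<omega>) (\<alpha> \<omega> t))"
    and "integrable (cond_prob W x) (\<lambda>\<omega>. H (state_at W \<alpha> t \<omega>))"
    and "integrable (cond_prob W x) (\<lambda>\<omega>. next_exp W H (state_at W \<alpha> t \<omega>) (\<alpha> \<omega> t))"
    and "integrable (cond_prob W x) (\<lambda>\<omega>. step_gain W H (state_at W \<alpha> t \<omega>) (\<alpha> \<omega> t))"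
proof -
  let ?P = "cond_prob W x"
  note P = cond_prob_prob[OF S x]
  note mP = measurable_cong_sets[OF P(2) refl]
  note act = nonanticipative_policy_actions[OF S \<alpha>]
  interpret P: prob_space ?P by (rule P)
  have W: "is_wcdp W" using S by (simp add: is_scenario_wcdp_def)
  have X: "state_at W \<alpha> t \<in> ?P \<rightarrow>\<^sub>M states W" "(\<lambda>\<omega>. \<alpha> \<omega> t) \<in> ?P \<rightarrow>\<^sub>M action_space W"
    using nonanticipative_policy_measurable[OF S \<alpha>] by (simp_all add: mP)
  have Hm: "H \<in> borel_measurable (states W)"
    using H by (simp add: bounded_measurable_def)
  obtain c where c: "\<And>x. x \<in> space (states W) \<Longrightarrow> \<bar>H x\<bar> \<le> c"
    using H by (auto simp: bounded_measurable_def bounded_iff)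
  obtain r where r: "\<And>x a. x \<in> space (states W) \<Longrightarrow> a \<in> actions W x \<Longrightarrow> \<bar>reward W x a\<bar> \<le> r"
    using reward_bounded[OF W] by blast
  show R: "integrable ?P (\<lambda>\<omega>. reward W (state_at W \<alpha> t \<omega>) (\<alpha> \<omega> t))"
    using act P(3) r
    by (intro P.integrable_const_bound[where B = r] measurable_reward[OF W X] AE_I2) auto
  show Hi: "integrable ?P (\<lambda>\<omega>. H (state_at W \<alpha> t \<omega>))"
    using act P(3) c
    by (intro P.integrable_const_bound[where B = c] measurable_compose[OF X(1) Hm] AE_I2) auto
  show N: "integrable ?P (\<lambda>\<omega>. next_exp W H (state_at W \<alpha> t \<omega>) (\<alpha> \<omega> t))"
    using act P(3) next_exp_bounded[OF W H c]
    by (intro P.integrable_const_bound[where B = c] measurable_next_exp[OF W X _ H] AE_I2) auto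
  show "integrable ?P (\<lambda>\<omega>. step_gain W H (state_at W \<alpha> t \<omega>) (\<alpha> \<omega> t))"
    unfolding step_gain_def
    by (intro Bochner_Integration.integrable_diff Bochner_Integration.integrable_add
        integrable_mult_right R N Hi)
qed

text \<open>
  With \<open>h\<^sub>t = E[H(x\<^sub>t)]\<close>, the mean gain is \<open>E[g\<^sub>t] = E[R\<^sub>t] + \<beta> h\<^sub>t\<^sub>+\<^sub>1 - h\<^sub>t\<close>. After multiplication by \<open>\<beta>\<^sup>t\<close>
  the \<open>h\<close>-terms are the increments of \<open>\<beta>\<^sup>t h\<^sub>t\<close>, which starts at \<open>H(x)\<close> and tends to \<open>0\<close>.
\<close>

lemma policy_value_eq_discounted_gains:
  fixes W :: "('n::finite, 'l::finite, 'x, 'a, 'w) scenario_wcdp"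
  assumes S: "is_scenario_wcdp W" and \<alpha>: "\<alpha> \<in> nonanticipative_policies W"
    and x: "x \<in> space (states W)" and H: "H \<in> bounded_measurable W"
  shows "policy_value W \<alpha> x = H x +
    (\<Sum>t. discount W ^ t * (\<integral>\<omega>. step_gain W H (state_at W \<alpha> t \<omega>) (\<alpha> \<omega> t) \<partial>cond_prob W x))"
proof -
  let ?P = "cond_prob W x"
  define R where "R t \<omega> = reward W (state_at W \<alpha> t \<omega>) (\<alpha> \<omega> t)" for t \<omega>
  define h where "h t = (\<integral>\<omega>. H (state_at W \<alpha> t \<omega>) \<partial>?P)" for t
  define b where "b = discount W"
  note P = cond_prob_prob[OF S x]
  note act = nonanticipative_policy_actions[OF S \<alpha>]
  note int = integrable_along_policy[OF S \<alpha> x H]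
  interpret P: prob_space ?P by (rule P)
  have W: "is_wcdp W" using S by (simp add: is_scenario_wcdp_def)
  then have b: "0 < b" "b < 1" by (auto simp: is_wcdp_def b_def)
  obtain c where c: "\<And>x. x \<in> space (states W) \<Longrightarrow> \<bar>H x\<bar> \<le> c"
    using H by (auto simp: bounded_measurable_def bounded_iff)
  obtain r where r: "\<And>x a. x \<in> space (states W) \<Longrightarrow> a \<in> actions W x \<Longrightarrow> \<bar>reward W x a\<bar> \<le> r"
    using reward_bounded[OF W] by blast
  have Rint: "integrable ?P (R t)" for t
    using int(1)[of t] by (simp add: R_def[abs_def])
  have Rb: "\<bar>R t \<omega>\<bar> \<le> r" if "\<omega> \<in> space ?P" for t \<omega>
    using r act that P(3) by (simp add: R_def)
  have abs_le: "\<bar>\<integral>\<omega>. f \<omega> \<partial>?P\<bar> \<le> k" "(\<integral>\<omega>. \<bar>f \<omega>\<bar> \<partial>?P) \<le> k"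
    if "integrable ?P f" "\<And>\<omega>. \<omega> \<in> space ?P \<Longrightarrow> \<bar>f \<omega>\<bar> \<le> k" for f :: "'w \<Rightarrow> real" and k
  proof -
    show le: "(\<integral>\<omega>. \<bar>f \<omega>\<bar> \<partial>?P) \<le> k"
      using that by (intro P.integral_le_const AE_I2) auto
    then show "\<bar>\<integral>\<omega>. f \<omega> \<partial>?P\<bar> \<le> k"
      using integral_abs_bound[of ?P f] by linarith
  qed
  have r0: "\<bar>\<integral>\<omega>. R t \<omega> \<partial>?P\<bar> \<le> r" for t
    by (rule abs_le(1)[OF Rint Rb])
  have gain: "(\<integral>\<omega>. step_gain W H (state_at W \<alpha> t \<omega>) (\<alpha> \<omega> t) \<partial>?P)
      = (\<integral>\<omega>. R t \<omega> \<partial>?P) + b * h (Suc t) - h t" for t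
    using int(1,2,3)[of t] expectation_next_exp[OF S \<alpha> x H, of t]
    by (simp add: step_gain_def R_def h_def b_def)
  have h_bound: "\<bar>h t\<bar> \<le> c" for t
    unfolding h_def using int(2) act P(3) c by (intro abs_le(1)) auto
  have h0: "h 0 = H x"
  proof -
    have "AE \<omega> in ?P. H (state_at W \<alpha> 0 \<omega>) = H x"
      using S x by (auto simp: is_scenario_wcdp_def state_at_def)
    then have "h 0 = (\<integral>\<omega>. H x \<partial>?P)"
      unfolding h_def using int(2)[of 0] by (intro integral_cong_AE) auto
    then show ?thesis by (simp add: P.prob_space)
  qed
  have "(\<lambda>t. b ^ t * h t) \<longlonglongrightarrow> 0"
    by (rule summable_LIMSEQ_zero[OF geometric_partial_sums_sums(1)[OF b h_bound]])
  then have "(\<lambda>t. b ^ Suc t * h (Suc t) - b ^ t * h t) sums (0 - b ^ 0 * h 0)"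
    by (rule telescope_sums)
  then have tele: "(\<lambda>t. b ^ Suc t * h (Suc t) - b ^ t * h t) sums (- H x)"
    by (simp add: h0)
  have Rsum: "summable (\<lambda>t. b ^ t * (\<integral>\<omega>. R t \<omega> \<partial>?P))"
    by (rule geometric_partial_sums_sums(1)[OF b r0])
  have "policy_value W \<alpha> x = (\<integral>\<omega>. (\<Sum>t. b ^ t * R t \<omega>) \<partial>?P)"
    by (simp add: policy_value_def R_def b_def)
  also have "\<dots> = (\<Sum>t. \<integral>\<omega>. b ^ t * R t \<omega> \<partial>?P)"
  proof (rule integral_suminf)
    show "integrable ?P (\<lambda>\<omega>. b ^ t * R t \<omega>)" for t
      using Rint by simp
    show "AE \<omega> in ?P. summable (\<lambda>t. norm (b ^ t * R t \<omega>))"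
    proof (rule AE_I2)
      fix \<omega> assume "\<omega> \<in> space ?P"
      then have "summable (\<lambda>t. b ^ t * \<bar>R t \<omega>\<bar>)"
        using Rb by (intro geometric_partial_sums_sums(1)[OF b, where K = r]) auto
      then show "summable (\<lambda>t. norm (b ^ t * R t \<omega>))"
        using b by (simp add: abs_mult)
    qed
    have "summable (\<lambda>t. b ^ t * (\<integral>\<omega>. \<bar>R t \<omega>\<bar> \<partial>?P))"
      using abs_le(2)[OF Rint Rb]
      by (intro geometric_partial_sums_sums(1)[OF b, where K = r]) auto
    then show "summable (\<lambda>t. \<integral>\<omega>. norm (b ^ t * R t \<omega>) \<partial>?P)"
      using b by (simp add: abs_mult)
  qed
  also have "\<dots> = (\<Sum>t. b ^ t * (\<integral>\<omega>. R t \<omega> \<partial>?P))"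
    by simp
  also have "\<dots> = H x + ((\<Sum>t. b ^ t * (\<integral>\<omega>. R t \<omega> \<partial>?P)) + - H x)"
    by simp
  also have "(\<Sum>t. b ^ t * (\<integral>\<omega>. R t \<omega> \<partial>?P)) + - H x =
      (\<Sum>t. b ^ t * (\<integral>\<omega>. R t \<omega> \<partial>?P) + (b ^ Suc t * h (Suc t) - b ^ t * h t))"
    using sums_add[OF summable_sums[OF Rsum] tele] by (simp add: sums_iff)
  also have "\<dots> = (\<Sum>t. b ^ t * (\<integral>\<omega>. step_gain W H (state_at W \<alpha> t \<omega>) (\<alpha> \<omega> t) \<partial>?P))"
    unfolding gain by (simp add: algebra_simps)
  finally show ?thesis
    by (simp add: b_def)
qed

section \<open>Pathwise maxima and the performance gap\<close>

lemma max_path_gain_greatest: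
  assumes "maxima_exist_measurably W H" "\<omega> \<in> space (scenarios W)"
  shows "max_path_gain W H T \<omega> \<in> path_gain W H \<omega> ` feasible_controls W (Suc T) \<omega>"
    and "as' \<in> feasible_controls W (Suc T) \<omega> \<Longrightarrow> path_gain W H \<omega> as' \<le> max_path_gain W H T \<omega>"
proof -
  obtain as where as: "as \<in> feasible_controls W (Suc T) \<omega>"
    "\<And>as'. as' \<in> feasible_controls W (Suc T) \<omega> \<Longrightarrow> path_gain W H \<omega> as' \<le> path_gain W H \<omega> as"
    using assms unfolding maxima_exist_measurably_def by blast
  have eq: "max_path_gain W H T \<omega> = path_gain W H \<omega> as"
    unfolding max_path_gain_def using as by (intro Greatest_equality) auto
  show "max_path_gain W H T \<omega> \<in> path_gain W H \<omega> ` feasible_controls W (Suc T) \<omega>"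
    unfolding eq using as(1) by (rule imageI)
  show "path_gain W H \<omega> as' \<le> max_path_gain W H T \<omega>" if "as' \<in> feasible_controls W (Suc T) \<omega>"
    unfolding eq using that by (rule as(2))
qed

text \<open>
  Every prefix of a feasible control sequence is feasible, so the whole trajectory stays in the
  state space, where the uniform bound on one-step gains applies.
\<close>

lemma path_gain_bounded:
  assumes S: "is_scenario_wcdp W" and \<omega>: "\<omega> \<in> space (scenarios W)"
    and K: "\<And>x a. x \<in> space (states W) \<Longrightarrow> a \<in> actions W x \<Longrightarrow> \<bar>step_gain W H x a\<bar> \<le> K"
    and as: "as \<in> feasible_controls W k \<omega>"
  shows "\<bar>path_gain W H \<omega> as\<bar> \<le> K * real k"
proof -
  have len: "length as = k" using as by (simp add: feasible_controls_def)
  have "\<bar>step_gain W H (state_map W (take t as) \<omega>) (as ! t)\<bar> \<le> K" if "t < k" for t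
  proof (rule K)
    have "take t as \<in> feasible_controls W t \<omega>"
      using as that by (auto simp: feasible_controls_def min_def)
    then show "state_map W (take t as) \<omega> \<in> space (states W)"
      using S \<omega> by (auto simp: is_scenario_wcdp_def)
    show "as ! t \<in> actions W (state_map W (take t as) \<omega>)"
      using as that by (auto simp: feasible_controls_def feasible_actions_def)
  qed
  then have "\<bar>path_gain W H \<omega> as\<bar> \<le> (\<Sum>t<k. K)"
    unfolding path_gain_def len by (intro order.trans[OF sum_abs] sum_mono) auto
  then show ?thesis by (simp add: mult.commute)
qed

text \<open>
  The controls chosen by a policy compete in the pathwise maximum; this makes the difference
  between the maximum and the gain of the policy nonnegative.
\<close>

lemma policy_controls_feasible:
  assumes "\<alpha> \<in> nonanticipative_policies W" "\<omega> \<in> space (scenarios W)"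
  shows "map (\<alpha> \<omega>) [0..<k] \<in> feasible_controls W k \<omega>"
    and "path_gain W H \<omega> (map (\<alpha> \<omega>) [0..<k]) = (\<Sum>t<k. step_gain W H (state_at W \<alpha> t \<omega>) (\<alpha> \<omega> t))"
  using assms
  by (auto simp: feasible_controls_def nonanticipative_policies_def path_gain_def state_at_def
      take_map intro!: sum.cong)

text \<open>
  Maximal and policy gain are both integrable over \<open>(\<omega>, \<tau>)\<close>, so the expectation of their difference
  splits. In the policy part the order of integration is exchanged: \<open>\<omega>\<close> is integrated out first for
  each fixed horizon, which reduces it to geometric stopping of the mean gains.
\<close>

lemma L_op_minus_policy_value:
  fixes W :: "('n::finite, 'l::finite, 'x, 'a, 'w) scenario_wcdp"
  assumes S: "is_scenario_wcdp W" and H: "H \<in> bounded_measurable W"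
    and M: "maxima_exist_measurably W H" and \<alpha>: "\<alpha> \<in> nonanticipative_policies W"
    and x: "x \<in> space (states W)"
  defines "D \<equiv> (\<lambda>(\<omega>, T). max_path_gain W H T \<omega> - (\<Sum>t\<le>T. step_gain W H (state_at W \<alpha> t \<omega>) (\<alpha> \<omega> t)))"
  shows "integrable (cond_prob W x \<Otimes>\<^sub>M measure_pmf (tau_law W)) D"
    and "L_op W H x - policy_value W \<alpha> x = (\<integral>z. D z \<partial>(cond_prob W x \<Otimes>\<^sub>M measure_pmf (tau_law W)))"
proof -
  let ?P = "cond_prob W x" and ?Q = "measure_pmf (tau_law W)"
  define g where "g t \<omega> = step_gain W H (state_at W \<alpha> t \<omega>) (\<alpha> \<omega> t)" for t \<omega>
  note P = cond_prob_prob[OF S x]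
  note mP = measurable_cong_sets[OF P(2) refl]
  note act = nonanticipative_policy_actions[OF S \<alpha>]
  interpret prob_P: prob_space ?P by (rule P)
  interpret pair_prob_space ?P ?Q ..
  have W: "is_wcdp W" using S by (simp add: is_scenario_wcdp_def)
  then have b: "0 < discount W" "discount W < 1" by (auto simp: is_wcdp_def)
  obtain K where K: "\<And>x a. x \<in> space (states W) \<Longrightarrow> a \<in> actions W x \<Longrightarrow> \<bar>step_gain W H x a\<bar> \<le> K"
    using step_gain_bounded[OF W H] by blast
  have gint: "integrable ?P (g t)" for t
    using integrable_along_policy(4)[OF S \<alpha> x H] by (simp add: g_def[abs_def])
  have prod_meas: "(\<lambda>(\<omega>, T). f T \<omega>) \<in> borel_measurable (?P \<Otimes>\<^sub>M ?Q)"
    if "\<And>T. f T \<in> borel_measurable ?P" for f :: "nat \<Rightarrow> 'w \<Rightarrow> real"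
  proof -
    have "(\<lambda>z. f (snd z) (fst z)) \<in> borel_measurable (?P \<Otimes>\<^sub>M ?Q)"
      by (rule measurable_compose_countable'[where I = UNIV and g = snd])
         (auto intro: measurable_compose[OF measurable_fst that] simp: measurable_pair_iff)
    then show ?thesis
      by (simp add: case_prod_beta)
  qed
  have prod_int: "integrable (?P \<Otimes>\<^sub>M ?Q) (\<lambda>(\<omega>, T). f T \<omega>)"
    if "\<And>T. f T \<in> borel_measurable ?P" "\<And>\<omega> T. \<omega> \<in> space ?P \<Longrightarrow> \<bar>f T \<omega>\<bar> \<le> K * (real T + 1)"
    for f :: "nat \<Rightarrow> 'w \<Rightarrow> real"
    unfolding tau_law_def
    by (rule integrable_geometric_linear_growth[OF P(1)])
       (use b that prod_meas[OF that(1)] in \<open>auto simp: tau_law_def\<close>)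
  have "\<bar>max_path_gain W H T \<omega>\<bar> \<le> K * (real T + 1)" if "\<omega> \<in> space ?P" for \<omega> T
  proof -
    have \<omega>: "\<omega> \<in> space (scenarios W)" using that P(3) by simp
    obtain as where as: "as \<in> feasible_controls W (Suc T) \<omega>" "max_path_gain W H T \<omega> = path_gain W H \<omega> as"
      using max_path_gain_greatest(1)[OF M \<omega>] by blast
    then show ?thesis
      using path_gain_bounded[OF S \<omega> K as(1)] by (simp add: as(2) add.commute)
  qed
  then have Mint: "integrable (?P \<Otimes>\<^sub>M ?Q) (\<lambda>(\<omega>, T). max_path_gain W H T \<omega>)"
    using M by (intro prod_int) (auto simp: maxima_exist_measurably_def mP)
  have Gb: "\<bar>\<Sum>t\<le>T. g t \<omega>\<bar> \<le> K * (real T + 1)" if "\<omega> \<in> space ?P" for \<omega> T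
  proof -
    have "\<bar>\<Sum>t\<le>T. g t \<omega>\<bar> \<le> (\<Sum>t\<le>T. K)"
      using that K act P(3) unfolding g_def by (intro order.trans[OF sum_abs] sum_mono) auto
    then show ?thesis by (simp add: mult.commute add.commute)
  qed
  have Gint: "integrable (?P \<Otimes>\<^sub>M ?Q) (\<lambda>(\<omega>, T). \<Sum>t\<le>T. g t \<omega>)"
    using gint Gb by (intro prod_int) auto
  have D_eq: "D = (\<lambda>z. (case z of (\<omega>, T) \<Rightarrow> max_path_gain W H T \<omega>) - (case z of (\<omega>, T) \<Rightarrow> \<Sum>t\<le>T. g t \<omega>))"
    by (auto simp: D_def g_def)
  show "integrable (?P \<Otimes>\<^sub>M ?Q) D"
    unfolding D_eq using Mint Gint by (rule Bochner_Integration.integrable_diff)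
  have ge: "\<bar>\<integral>\<omega>. g t \<omega> \<partial>?P\<bar> \<le> K" for t
  proof -
    have "(\<integral>\<omega>. \<bar>g t \<omega>\<bar> \<partial>?P) \<le> K"
      using gint K act P(3) unfolding g_def by (intro prob_P.integral_le_const AE_I2) auto
    then show ?thesis using integral_abs_bound[of ?P "g t"] by linarith
  qed
  have "(\<integral>z. (case z of (\<omega>, T) \<Rightarrow> \<Sum>t\<le>T. g t \<omega>) \<partial>(?P \<Otimes>\<^sub>M ?Q)) = (\<integral>T. (\<integral>\<omega>. (\<Sum>t\<le>T. g t \<omega>) \<partial>?P) \<partial>?Q)"
    using integral_snd[OF Gint] by simp
  also have "\<dots> = (\<integral>T. (\<Sum>t\<le>T. \<integral>\<omega>. g t \<omega> \<partial>?P) \<partial>?Q)"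
    using gint by simp
  also have "\<dots> = (\<Sum>t. discount W ^ t * (\<integral>\<omega>. g t \<omega> \<partial>?P))"
    unfolding tau_law_def by (rule expectation_geometric_partial_sums[OF b ge])
  also have "\<dots> = policy_value W \<alpha> x - H x"
    using policy_value_eq_discounted_gains[OF S \<alpha> x H] by (simp add: g_def)
  finally have "(\<integral>z. (case z of (\<omega>, T) \<Rightarrow> \<Sum>t\<le>T. g t \<omega>) \<partial>(?P \<Otimes>\<^sub>M ?Q)) = policy_value W \<alpha> x - H x" .
  then show "L_op W H x - policy_value W \<alpha> x = (\<integral>z. D z \<partial>(?P \<Otimes>\<^sub>M ?Q))"
    unfolding D_eq Bochner_Integration.integral_diff[OF Mint Gint] L_op_def by linarith
qed

text \<open>
  A nonnegative integrand has integral zero iff it vanishes almost everywhere. A geometric law has no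
  null point, so almost every \<open>T\<close> is every \<open>T\<close>.
\<close>

lemma policy_value_eq_L_op_iff:
  fixes W :: "('n::finite, 'l::finite, 'x, 'a, 'w) scenario_wcdp"
  assumes S: "is_scenario_wcdp W" and H: "H \<in> bounded_measurable W"
    and M: "maxima_exist_measurably W H" and \<alpha>: "\<alpha> \<in> nonanticipative_policies W"
    and x: "x \<in> space (states W)"
  shows "policy_value W \<alpha> x = L_op W H x \<longleftrightarrow>
    (AE \<omega> in cond_prob W x. \<forall>T. max_path_gain W H T \<omega>
        = (\<Sum>t\<le>T. step_gain W H (state_at W \<alpha> t \<omega>) (\<alpha> \<omega> t)))"
proof -
  let ?P = "cond_prob W x" and ?Q = "measure_pmf (tau_law W)"
  define D where "D = (\<lambda>(\<omega>, T). max_path_gain W H T \<omega>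
      - (\<Sum>t\<le>T. step_gain W H (state_at W \<alpha> t \<omega>) (\<alpha> \<omega> t)))"
  note D = L_op_minus_policy_value[OF S H M \<alpha> x, folded D_def]
  note P = cond_prob_prob[OF S x]
  interpret prob_P: prob_space ?P by (rule P)
  interpret pair_prob_space ?P ?Q ..
  have b: "0 < discount W" "discount W < 1"
    using S by (auto simp: is_scenario_wcdp_def is_wcdp_def)
  have D0: "0 \<le> D (\<omega>, T)" if "\<omega> \<in> space ?P" for \<omega> T
  proof -
    have \<omega>: "\<omega> \<in> space (scenarios W)" using that P(3) by simp
    show ?thesis
      using max_path_gain_greatest(2)[OF M \<omega> policy_controls_feasible(1)[OF \<alpha> \<omega>]]
      by (simp add: D_def policy_controls_feasible(2)[OF \<alpha> \<omega>] lessThan_Suc_atMost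
          del: upt_Suc)
  qed
  have "policy_value W \<alpha> x = L_op W H x \<longleftrightarrow> (\<integral>z. D z \<partial>(?P \<Otimes>\<^sub>M ?Q)) = 0"
    using D(2) by linarith
  also have "\<dots> \<longleftrightarrow> (AE z in ?P \<Otimes>\<^sub>M ?Q. D z = 0)"
    using D0 by (intro integral_nonneg_eq_0_iff_AE[OF D(1)] AE_I2) (auto simp: space_pair_measure)
  also have "\<dots> \<longleftrightarrow> (AE \<omega> in ?P. AE T in ?Q. D (\<omega>, T) = 0)"
    using AE_pair_iff[of "\<lambda>\<omega> T. D (\<omega>, T) = 0"] D(1) by simp
  also have "\<dots> \<longleftrightarrow> (AE \<omega> in ?P. \<forall>T. D (\<omega>, T) = 0)"
    using b by (simp add: AE_measure_pmf_iff tau_law_def set_pmf_geometric)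
  finally show ?thesis
    by (simp add: D_def)
qed

section \<open>Characterisation of equality and greedy actions\<close>

text \<open>
  For \<open>T = 0\<close> the pathwise maximum ranges over the feasible actions in \<open>x\<close> and depends on the scenario
  only through its initial state. One scenario starting in \<open>x\<close> at which the maximality holds therefore
  decides the claim, and almost every scenario is of this kind. The summand \<open>-H(x)\<close> of the gain is the
  same for all actions.
\<close>

lemma pathwise_maximal_greedy:
  assumes S: "is_scenario_wcdp W" and M: "maxima_exist_measurably W H"
    and \<delta>: "\<And>x. x \<in> space (states W) \<Longrightarrow> \<delta> x \<in> feasible_actions W x"
    and max: "pathwise_maximal W H \<alpha> \<delta>" and x: "x \<in> space (states W)"
  shows "is_arg_max (\<lambda>a. reward W x a + discount W * next_exp W H x a)
    (\<lambda>a. a \<in> feasible_actions W x) (\<delta> x)"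
proof -
  note P = cond_prob_prob[OF S x]
  interpret prob_space "cond_prob W x" by (rule P)
  have "AE \<omega> in cond_prob W x. \<omega> \<in> space (scenarios W) \<and> state_map W [] \<omega> = x \<and>
      max_path_gain W H 0 \<omega> = step_gain W H x (\<delta> x)"
  proof -
    have "AE \<omega> in cond_prob W x. \<omega> \<in> space (scenarios W)"
      using AE_space[of "cond_prob W x"] P(3) by simp
    moreover have "AE \<omega> in cond_prob W x. state_map W [] \<omega> = x"
      using S x by (auto simp: is_scenario_wcdp_def)
    moreover have "AE \<omega> in cond_prob W x. \<forall>T. max_path_gain W H T \<omega>
        = (\<Sum>t\<le>T. step_gain W H (state_at W \<alpha> t \<omega>) (\<delta> (state_at W \<alpha> t \<omega>)))"
      using max x by (auto simp: pathwise_maximal_def)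
    ultimately show ?thesis
      by eventually_elim (auto simp: state_at_def dest!: spec[of _ 0])
  qed
  from eventually_happens'[OF ae_filter_bot this]
  obtain \<omega> where \<omega>: "\<omega> \<in> space (scenarios W)" "state_map W [] \<omega> = x"
    "max_path_gain W H 0 \<omega> = step_gain W H x (\<delta> x)"
    by blast
  have "step_gain W H x a \<le> step_gain W H x (\<delta> x)" if "a \<in> feasible_actions W x" for a
  proof -
    have "[a] \<in> feasible_controls W (Suc 0) \<omega>"
      using that \<omega>(2) by (simp add: feasible_controls_def)
    from max_path_gain_greatest(2)[OF M \<omega>(1) this] show ?thesis
      using \<omega>(2,3) by (simp add: path_gain_def)
  qed
  then show ?thesis
    using \<delta>[OF x] by (fastforce simp: is_arg_max_def step_gain_def not_less)
qed

theorem theorem4: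
  fixes W :: "('n::finite, 'l::finite, 'x, 'a, 'w) scenario_wcdp"
    and H :: "('n \<Rightarrow> 'x) \<Rightarrow> real"
    and \<alpha> :: "'w \<Rightarrow> nat \<Rightarrow> 'n \<Rightarrow> 'a"
    and \<delta> :: "('n \<Rightarrow> 'x) \<Rightarrow> ('n \<Rightarrow> 'a)"
  assumes "is_scenario_wcdp W"
    and "H \<in> bounded_measurable W"
    and "maxima_exist_measurably W H"
    and "\<alpha> \<in> nonanticipative_policies W"
    and "stationary_markov W \<alpha> \<delta>"
  shows "((\<forall>x\<in>space (states W). policy_value W \<alpha> x = L_op W H x) \<longleftrightarrow> pathwise_maximal W H \<alpha> \<delta>) \<and>
         (pathwise_maximal W H \<alpha> \<delta> \<longrightarrow>
            (\<forall>x\<in>space (states W).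
               is_arg_max (\<lambda>a. reward W x a + discount W * next_exp W H x a)
                 (\<lambda>a. a \<in> feasible_actions W x) (\<delta> x)))"
proof (intro conjI impI ballI)
  have \<delta>: "\<And>x. x \<in> space (states W) \<Longrightarrow> \<delta> x \<in> feasible_actions W x"
    and \<alpha>_eq: "\<And>\<omega> t. \<omega> \<in> space (scenarios W) \<Longrightarrow> \<alpha> \<omega> t = \<delta> (state_at W \<alpha> t \<omega>)"
    using assms(5) by (auto simp: stationary_markov_def)
  have "policy_value W \<alpha> x = L_op W H x \<longleftrightarrow>
      (AE \<omega> in cond_prob W x. \<forall>T. max_path_gain W H T \<omega>
        = (\<Sum>t\<le>T. step_gain W H (state_at W \<alpha> t \<omega>) (\<delta> (state_at W \<alpha> t \<omega>))))"
    if x: "x \<in> space (states W)" for x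
    unfolding policy_value_eq_L_op_iff[OF assms(1-4) x]
    using cond_prob_prob(3)[OF assms(1) x] \<alpha>_eq by (intro AE_cong) simp
  then show "(\<forall>x\<in>space (states W). policy_value W \<alpha> x = L_op W H x) \<longleftrightarrow> pathwise_maximal W H \<alpha> \<delta>"
    unfolding pathwise_maximal_def by (rule ball_cong[OF refl])
  show "is_arg_max (\<lambda>a. reward W x a + discount W * next_exp W H x a)
      (\<lambda>a. a \<in> feasible_actions W x) (\<delta> x)"
    if "pathwise_maximal W H \<alpha> \<delta>" "x \<in> space (states W)" for x
    using pathwise_maximal_greedy[OF assms(1,3) \<delta> that] .
qed

end
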